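(* Every typed $\lambda\mu^{\rightarrow\wedge\vee}$-term is strongly normalizable: if $\Gamma \vdash M : A$ is derivable in the system ${\cal S}^{\rightarrow\wedge\vee}$ (for some context $\Gamma$ and type $A$), then there is no infinite sequence of reductions $M \triangleright M_1 \triangleright M_2 \triangleright \cdots$.
   Context: Let ${\cal V}$ (term variables $x,y,\dots$) and ${\cal W}$ ($\mu$-variables $\alpha,\beta,\dots$) be disjoint infinite sets. The $\lambda\mu^{\rightarrow\wedge\vee}$-terms $M$ and eliminators $\varepsilon$ are given by $M ::= x \mid \lambda x.M \mid (M\;\varepsilon) \mid \langle M,M\rangle \mid \omega_1 M \mid \omega_2 M \mid \mu\alpha.M \mid (\alpha\; M)$, $\varepsilon ::= M \mid \pi_1 \mid \pi_2 \mid [x_1.M, x_2.M]$, where $\lambda x$, $\mu\alpha$ and the $x_i$ in $[x_1.N_1,x_2.N_2]$ are binders. $M[(\alpha\;L):=(\alpha\;(L\;\varepsilon))]$ denotes the result of replacing (recursively, inside $L$ as well) every subterm of $M$ of the form $(\alpha\;L)$ by $(\alpha\;(L\;\varepsilon))$. The reduction $\triangleright$ is the compatible closure (reduction inside any subterm) of the rules: $(\lambda x.M\;N)\triangleright M[x:=N]$; $(\mu\alpha.M\;\varepsilon)\triangleright \mu\alpha.M[(\alpha\;L):=(\alpha\;(L\;\varepsilon))]$; $(\langle M_1,M_2\rangle\;\pi_i)\triangleright M_i$; $(\omega_i M\;[x_1.N_1,x_2.N_2])\triangleright N_i[x_i:=M]$; $((M\;[x_1.N_1,x_2.N_2])\;\varepsilon)\triangleright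 (M\;[x_1.(N_1\;\varepsilon),x_2.(N_2\;\varepsilon)])$ ($i=1,2$). Types: $A ::= X \mid \bot \mid A\rightarrow A \mid A\wedge A \mid A\vee A$ with $X$ ranging over a set ${\cal A}$ of atomic constants; $\neg A$ abbreviates $A\rightarrow\bot$. A context is a set of declarations $x:A$ or $\alpha:\neg B$, each variable declared at most once. Typing rules of ${\cal S}^{\rightarrow\wedge\vee}$: $\Gamma, x:A\vdash x:A$; from $\Gamma,x:A\vdash M:B$ infer $\Gamma\vdash\lambda x.M:A\rightarrow B$; from $\Gamma\vdash M:A\rightarrow B$ and $\Gamma\vdash N:A$ infer $\Gamma\vdash (M\;N):B$; from $\Gamma,\alpha:\neg A\vdash M:A$ infer $\Gamma,\alpha:\neg A\vdash(\alpha\;M):\bot$; from $\Gamma,\alpha:\neg A\vdash M:\bot$ infer $\Gamma\vdash\mu\alpha.M:A$; from $\Gamma\vdash M:A_1$ and $\Gamma\vdash N:A_2$ infer $\Gamma\vdash\langle M,N\rangle:A_1\wedge A_2$; from $\Gamma\vdash M:A_1\wedge A_2$ infer $\Gamma\vdash(M\;\pi_i):A_i$; from $\Gamma\vdash M:A_j$ infer $\Gamma\vdash\omega_j M:A_1\vee A_2$; from $\Gamma\vdash M:A_1\vee A_2$, $\Gamma,x_1:A_1\vdash N_1:C$, $\Gamma,x_2:A_2\vdash N_2:C$ infer $\Gamma\vdash(M\;[x_1.N_1,x_2.N_2]):C$. *)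

theory Defs
  imports Main
begin

text \<open>
  Terms are taken up to renaming of bound variables, in de Bruijn notation with two independent
  index spaces: one for the term variables (bound by \<open>Lam\<close> and by each branch of \<open>Case\<close>) and
  one for the \<open>\<mu>\<close>-variables (bound by \<open>Mu\<close>). \<open>Nam \<alpha> M\<close> is \<open>(\<alpha> M)\<close>, and \<open>App M \<epsilon>\<close> is \<open>(M \<epsilon>)\<close>.
\<close>

datatype trm =
    Var nat
  | Lam trm
  | App trm elim
  | Pair trm trm
  | Inj1 trm
  | Inj2 trm
  | Mu trm
  | Nam nat trm
and elim =
    Arg trm
  | Proj1
  | Proj2
  | Case trm trm


primrec lift_v :: "trm \<Rightarrow> nat \<Rightarrow> trm" and lift_v_e :: "elim \<Rightarrow> nat \<Rightarrow> elim" where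
  "lift_v (Var x) k = (if x < k then Var x else Var (Suc x))"
| "lift_v (Lam M) k = Lam (lift_v M (Suc k))"
| "lift_v (App M e) k = App (lift_v M k) (lift_v_e e k)"
| "lift_v (Pair M N) k = Pair (lift_v M k) (lift_v N k)"
| "lift_v (Inj1 M) k = Inj1 (lift_v M k)"
| "lift_v (Inj2 M) k = Inj2 (lift_v M k)"
| "lift_v (Mu M) k = Mu (lift_v M k)"
| "lift_v (Nam a M) k = Nam a (lift_v M k)"
| "lift_v_e (Arg M) k = Arg (lift_v M k)"
| "lift_v_e Proj1 k = Proj1"
| "lift_v_e Proj2 k = Proj2"
| "lift_v_e (Case M N) k = Case (lift_v M (Suc k)) (lift_v N (Suc k))"

primrec lift_m :: "trm \<Rightarrow> nat \<Rightarrow> trm" and lift_m_e :: "elim \<Rightarrow> nat \<Rightarrow> elim" where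
  "lift_m (Var x) k = Var x"
| "lift_m (Lam M) k = Lam (lift_m M k)"
| "lift_m (App M e) k = App (lift_m M k) (lift_m_e e k)"
| "lift_m (Pair M N) k = Pair (lift_m M k) (lift_m N k)"
| "lift_m (Inj1 M) k = Inj1 (lift_m M k)"
| "lift_m (Inj2 M) k = Inj2 (lift_m M k)"
| "lift_m (Mu M) k = Mu (lift_m M (Suc k))"
| "lift_m (Nam a M) k = Nam (if a < k then a else Suc a) (lift_m M k)"
| "lift_m_e (Arg M) k = Arg (lift_m M k)"
| "lift_m_e Proj1 k = Proj1"
| "lift_m_e Proj2 k = Proj2"
| "lift_m_e (Case M N) k = Case (lift_m M k) (lift_m N k)"

text \<open>
  \<open>subst M N k\<close> is \<open>M[k := N]\<close>; as the binder of \<open>k\<close> disappears in a reduction step, the term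
  variables above \<open>k\<close> are lowered by one.
\<close>

primrec subst :: "trm \<Rightarrow> trm \<Rightarrow> nat \<Rightarrow> trm" and subst_e :: "elim \<Rightarrow> trm \<Rightarrow> nat \<Rightarrow> elim" where
  "subst (Var x) N k = (if x < k then Var x else if x = k then N else Var (x - 1))"
| "subst (Lam M) N k = Lam (subst M (lift_v N 0) (Suc k))"
| "subst (App M e) N k = App (subst M N k) (subst_e e N k)"
| "subst (Pair M M') N k = Pair (subst M N k) (subst M' N k)"
| "subst (Inj1 M) N k = Inj1 (subst M N k)"
| "subst (Inj2 M) N k = Inj2 (subst M N k)"
| "subst (Mu M) N k = Mu (subst M (lift_m N 0) k)"
| "subst (Nam a M) N k = Nam a (subst M N k)"
| "subst_e (Arg M) N k = Arg (subst M N k)"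
| "subst_e Proj1 N k = Proj1"
| "subst_e Proj2 N k = Proj2"
| "subst_e (Case M M') N k =
     Case (subst M (lift_v N 0) (Suc k)) (subst M' (lift_v N 0) (Suc k))"

text \<open>
  \<open>msubst M e a\<close> is \<open>M[(a L) := (a (L e))]\<close>. Its binder \<open>\<mu>a\<close> survives the reduction step, so no
  index is lowered.
\<close>

primrec msubst :: "trm \<Rightarrow> elim \<Rightarrow> nat \<Rightarrow> trm" and msubst_e :: "elim \<Rightarrow> elim \<Rightarrow> nat \<Rightarrow> elim" where
  "msubst (Var x) e a = Var x"
| "msubst (Lam M) e a = Lam (msubst M (lift_v_e e 0) a)"
| "msubst (App M d) e a = App (msubst M e a) (msubst_e d e a)"
| "msubst (Pair M N) e a = Pair (msubst M e a) (msubst N e a)"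
| "msubst (Inj1 M) e a = Inj1 (msubst M e a)"
| "msubst (Inj2 M) e a = Inj2 (msubst M e a)"
| "msubst (Mu M) e a = Mu (msubst M (lift_m_e e 0) (Suc a))"
| "msubst (Nam b L) e a =
     (if b = a then Nam b (App (msubst L e a) e) else Nam b (msubst L e a))"
| "msubst_e (Arg M) e a = Arg (msubst M e a)"
| "msubst_e Proj1 e a = Proj1"
| "msubst_e Proj2 e a = Proj2"
| "msubst_e (Case M N) e a =
     Case (msubst M (lift_v_e e 0) a) (msubst N (lift_v_e e 0) a)"


inductive red :: "trm \<Rightarrow> trm \<Rightarrow> bool" (infix "\<triangleright>" 50)
  and red_e :: "elim \<Rightarrow> elim \<Rightarrow> bool" (infix "\<triangleright>\<^sub>e" 50) where
  beta: "App (Lam M) (Arg N) \<triangleright> subst M N 0"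
| mu: "App (Mu M) e \<triangleright> Mu (msubst M (lift_m_e e 0) 0)"
| proj1: "App (Pair M1 M2) Proj1 \<triangleright> M1"
| proj2: "App (Pair M1 M2) Proj2 \<triangleright> M2"
| case1: "App (Inj1 M) (Case N1 N2) \<triangleright> subst N1 M 0"
| case2: "App (Inj2 M) (Case N1 N2) \<triangleright> subst N2 M 0"
| perm: "App (App M (Case N1 N2)) e \<triangleright>
    App M (Case (App N1 (lift_v_e e 0)) (App N2 (lift_v_e e 0)))"
| Lam: "M \<triangleright> M' \<Longrightarrow> Lam M \<triangleright> Lam M'"
| AppL: "M \<triangleright> M' \<Longrightarrow> App M e \<triangleright> App M' e"
| AppR: "e \<triangleright>\<^sub>e e' \<Longrightarrow> App M e \<triangleright> App M e'"
| PairL: "M \<triangleright> M' \<Longrightarrow> Pair M N \<triangleright> Pair M' N"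
| PairR: "N \<triangleright> N' \<Longrightarrow> Pair M N \<triangleright> Pair M N'"
| Inj1: "M \<triangleright> M' \<Longrightarrow> Inj1 M \<triangleright> Inj1 M'"
| Inj2: "M \<triangleright> M' \<Longrightarrow> Inj2 M \<triangleright> Inj2 M'"
| Mu: "M \<triangleright> M' \<Longrightarrow> Mu M \<triangleright> Mu M'"
| Nam: "M \<triangleright> M' \<Longrightarrow> Nam a M \<triangleright> Nam a M'"
| Arg: "M \<triangleright> M' \<Longrightarrow> Arg M \<triangleright>\<^sub>e Arg M'"
| CaseL: "M \<triangleright> M' \<Longrightarrow> Case M N \<triangleright>\<^sub>e Case M' N"
| CaseR: "N \<triangleright> N' \<Longrightarrow> Case M N \<triangleright>\<^sub>e Case M N'"


datatype 'a ty =
    Atom 'a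
  | Bot
  | Imp "'a ty" "'a ty"
  | Conj "'a ty" "'a ty"
  | Disj "'a ty" "'a ty"

text \<open>
  A context is a pair of partial maps: \<open>\<Gamma> x = Some A\<close> is the declaration \<open>x : A\<close> and
  \<open>\<Delta> \<alpha> = Some B\<close> is the declaration \<open>\<alpha> : \<not>B\<close> (the map records \<open>B\<close>, not \<open>\<not>B\<close>).
  \<open>A \<Colon> \<Gamma>\<close> declares the new variable 0 and moves the other declarations up by one.
\<close>

type_synonym 'a ctx = "nat \<Rightarrow> 'a ty option"

definition ctx_ext :: "'a ty \<Rightarrow> 'a ctx \<Rightarrow> 'a ctx" (infixr "\<Colon>" 65) where
  "A \<Colon> \<Gamma> = case_nat (Some A) \<Gamma>"

inductive typing :: "'a ctx \<Rightarrow> 'a ctx \<Rightarrow> trm \<Rightarrow> 'a ty \<Rightarrow> bool"  ("_; _ \<turnstile> _ : _" [50, 50, 50, 50] 50)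
where
  ax: "\<Gamma> x = Some A \<Longrightarrow> \<Gamma>; \<Delta> \<turnstile> Var x : A"
| imp_i: "A \<Colon> \<Gamma>; \<Delta> \<turnstile> M : B \<Longrightarrow> \<Gamma>; \<Delta> \<turnstile> Lam M : Imp A B"
| imp_e: "\<Gamma>; \<Delta> \<turnstile> M : Imp A B \<Longrightarrow> \<Gamma>; \<Delta> \<turnstile> N : A \<Longrightarrow> \<Gamma>; \<Delta> \<turnstile> App M (Arg N) : B"
| bot_i: "\<Delta> a = Some A \<Longrightarrow> \<Gamma>; \<Delta> \<turnstile> M : A \<Longrightarrow> \<Gamma>; \<Delta> \<turnstile> Nam a M : Bot"
| bot_e: "\<Gamma>; A \<Colon> \<Delta> \<turnstile> M : Bot \<Longrightarrow> \<Gamma>; \<Delta> \<turnstile> Mu M : A"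
| conj_i: "\<Gamma>; \<Delta> \<turnstile> M : A1 \<Longrightarrow> \<Gamma>; \<Delta> \<turnstile> N : A2 \<Longrightarrow> \<Gamma>; \<Delta> \<turnstile> Pair M N : Conj A1 A2"
| conj_e1: "\<Gamma>; \<Delta> \<turnstile> M : Conj A1 A2 \<Longrightarrow> \<Gamma>; \<Delta> \<turnstile> App M Proj1 : A1"
| conj_e2: "\<Gamma>; \<Delta> \<turnstile> M : Conj A1 A2 \<Longrightarrow> \<Gamma>; \<Delta> \<turnstile> App M Proj2 : A2"
| disj_i1: "\<Gamma>; \<Delta> \<turnstile> M : A1 \<Longrightarrow> \<Gamma>; \<Delta> \<turnstile> Inj1 M : Disj A1 A2"
| disj_i2: "\<Gamma>; \<Delta> \<turnstile> M : A2 \<Longrightarrow> \<Gamma>; \<Delta> \<turnstile> Inj2 M : Disj A1 A2"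
| disj_e: "\<Gamma>; \<Delta> \<turnstile> M : Disj A1 A2 \<Longrightarrow> A1 \<Colon> \<Gamma>; \<Delta> \<turnstile> N1 : C \<Longrightarrow> A2 \<Colon> \<Gamma>; \<Delta> \<turnstile> N2 : C \<Longrightarrow>
    \<Gamma>; \<Delta> \<turnstile> App M (Case N1 N2) : C"

end

(* Biorthogonality. A type is interpreted by a set of stacks (sequences of eliminators), and a term
   is reducible when it is strongly normalizing in front of every such stack. Each redex at the
   head of a stack is strongly normalizing as soon as its contractum and the discarded parts are.
   The permutative conversions fit in because a permutation inside a stack is independent of the
   term in head position, while a permutation moving a stack into the branches of a head
   [x1.N1, x2.N2] leaves the terms (N1 s) and (N2 s) unchanged and shortens the stack s.
   The free mu-variables are instantiated by stacks, so that (mu a.M) s is controlled by M in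
   which every (a L) has become (a (L s)). *)
theory Submission
  imports Defs
begin

section \<open>Parallel substitution\<close>

definition up_ren :: "(nat \<Rightarrow> nat) \<Rightarrow> nat \<Rightarrow> nat" where
  "up_ren \<rho> = case_nat 0 (\<lambda>x. Suc (\<rho> x))"

primrec ren :: "trm \<Rightarrow> (nat \<Rightarrow> nat) \<Rightarrow> (nat \<Rightarrow> nat) \<Rightarrow> trm"
  and ren_e :: "elim \<Rightarrow> (nat \<Rightarrow> nat) \<Rightarrow> (nat \<Rightarrow> nat) \<Rightarrow> elim" where
  "ren (Var x) \<rho> \<theta> = Var (\<rho> x)"
| "ren (Lam M) \<rho> \<theta> = Lam (ren M (up_ren \<rho>) \<theta>)"
| "ren (App M e) \<rho> \<theta> = App (ren M \<rho> \<theta>) (ren_e e \<rho> \<theta>)"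
| "ren (Pair M N) \<rho> \<theta> = Pair (ren M \<rho> \<theta>) (ren N \<rho> \<theta>)"
| "ren (Inj1 M) \<rho> \<theta> = Inj1 (ren M \<rho> \<theta>)"
| "ren (Inj2 M) \<rho> \<theta> = Inj2 (ren M \<rho> \<theta>)"
| "ren (Mu M) \<rho> \<theta> = Mu (ren M \<rho> (up_ren \<theta>))"
| "ren (Nam a M) \<rho> \<theta> = Nam (\<theta> a) (ren M \<rho> \<theta>)"
| "ren_e (Arg M) \<rho> \<theta> = Arg (ren M \<rho> \<theta>)"
| "ren_e Proj1 \<rho> \<theta> = Proj1"
| "ren_e Proj2 \<rho> \<theta> = Proj2"
| "ren_e (Case M N) \<rho> \<theta> = Case (ren M (up_ren \<rho>) \<theta>) (ren N (up_ren \<rho>) \<theta>)"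

abbreviation sh_v :: "trm \<Rightarrow> trm" where "sh_v M \<equiv> lift_v M 0"
abbreviation sh_ve :: "elim \<Rightarrow> elim" where "sh_ve e \<equiv> lift_v_e e 0"
abbreviation sh_m :: "trm \<Rightarrow> trm" where "sh_m M \<equiv> lift_m M 0"
abbreviation sh_me :: "elim \<Rightarrow> elim" where "sh_me e \<equiv> lift_m_e e 0"

definition apps :: "trm \<Rightarrow> elim list \<Rightarrow> trm" where
  "apps M s = foldl App M s"

lemma apps_simps [simp]:
  "apps M [] = M"
  "apps M (e # s) = apps (App M e) s"
  "apps M (s @ t) = apps (apps M s) t"
  by (simp_all add: apps_def)

definition up_v :: "(nat \<Rightarrow> trm) \<Rightarrow> nat \<Rightarrow> trm" where
  "up_v \<sigma> = case_nat (Var 0) (\<lambda>x. sh_v (\<sigma> x))"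

text \<open>The empty stack at index 0 leaves occurrences of the newly bound \<mu>-variable as they
  are.\<close>

definition up_m :: "(nat \<Rightarrow> elim list) \<Rightarrow> nat \<Rightarrow> elim list" where
  "up_m \<kappa> = case_nat [] (\<lambda>a. map sh_me (\<kappa> a))"

text \<open>Besides instantiating the term variables by \<open>\<sigma>\<close>, this replaces every \<open>(\<alpha> L)\<close> by
  \<open>(\<theta> \<alpha> (L \<kappa>\<^sub>\<alpha>))\<close> for a whole sequence \<open>\<kappa>\<^sub>\<alpha>\<close> of eliminators.\<close>

primrec psub :: "trm \<Rightarrow> (nat \<Rightarrow> trm) \<Rightarrow> (nat \<Rightarrow> nat) \<Rightarrow> (nat \<Rightarrow> elim list) \<Rightarrow> trm"
  and psub_e :: "elim \<Rightarrow> (nat \<Rightarrow> trm) \<Rightarrow> (nat \<Rightarrow> nat) \<Rightarrow> (nat \<Rightarrow> elim list) \<Rightarrow> elim" where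
  "psub (Var x) \<sigma> \<theta> \<kappa> = \<sigma> x"
| "psub (Lam M) \<sigma> \<theta> \<kappa> = Lam (psub M (up_v \<sigma>) \<theta> (\<lambda>a. map sh_ve (\<kappa> a)))"
| "psub (App M e) \<sigma> \<theta> \<kappa> = App (psub M \<sigma> \<theta> \<kappa>) (psub_e e \<sigma> \<theta> \<kappa>)"
| "psub (Pair M N) \<sigma> \<theta> \<kappa> = Pair (psub M \<sigma> \<theta> \<kappa>) (psub N \<sigma> \<theta> \<kappa>)"
| "psub (Inj1 M) \<sigma> \<theta> \<kappa> = Inj1 (psub M \<sigma> \<theta> \<kappa>)"
| "psub (Inj2 M) \<sigma> \<theta> \<kappa> = Inj2 (psub M \<sigma> \<theta> \<kappa>)"
| "psub (Mu M) \<sigma> \<theta> \<kappa> = Mu (psub M (\<lambda>x. sh_m (\<sigma> x)) (up_ren \<theta>) (up_m \<kappa>))"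
| "psub (Nam a M) \<sigma> \<theta> \<kappa> = Nam (\<theta> a) (apps (psub M \<sigma> \<theta> \<kappa>) (\<kappa> a))"
| "psub_e (Arg M) \<sigma> \<theta> \<kappa> = Arg (psub M \<sigma> \<theta> \<kappa>)"
| "psub_e Proj1 \<sigma> \<theta> \<kappa> = Proj1"
| "psub_e Proj2 \<sigma> \<theta> \<kappa> = Proj2"
| "psub_e (Case M N) \<sigma> \<theta> \<kappa> =
     Case (psub M (up_v \<sigma>) \<theta> (\<lambda>a. map sh_ve (\<kappa> a))) (psub N (up_v \<sigma>) \<theta> (\<lambda>a. map sh_ve (\<kappa> a)))"

section \<open>Shifts as renamings, and composition laws for renamings and substitutions\<close>

lemma lift_v_ren:
  "lift_v M k = ren M (\<lambda>x. if x < k then x else Suc x) id"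
  "lift_v_e e k = ren_e e (\<lambda>x. if x < k then x else Suc x) id"
proof -
  have "up_ren id = id" "\<And>k. up_ren (\<lambda>x. if x < k then x else Suc x) = (\<lambda>x. if x < Suc k then x else Suc x)"
    by (auto simp: up_ren_def fun_eq_iff split: nat.split)
  then show "lift_v M k = ren M (\<lambda>x. if x < k then x else Suc x) id"
    "lift_v_e e k = ren_e e (\<lambda>x. if x < k then x else Suc x) id"
    by (induction M and e arbitrary: k and k) simp_all
qed

lemma lift_m_ren:
  "lift_m M k = ren M id (\<lambda>x. if x < k then x else Suc x)"
  "lift_m_e e k = ren_e e id (\<lambda>x. if x < k then x else Suc x)"
proof -
  have "up_ren id = id" "\<And>k. up_ren (\<lambda>x. if x < k then x else Suc x) = (\<lambda>x. if x < Suc k then x else Suc x)"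
    by (auto simp: up_ren_def fun_eq_iff split: nat.split)
  then show "lift_m M k = ren M id (\<lambda>x. if x < k then x else Suc x)"
    "lift_m_e e k = ren_e e id (\<lambda>x. if x < k then x else Suc x)"
    by (induction M and e arbitrary: k and k) simp_all
qed

lemma shift_ren:
  "sh_v M = ren M Suc id" "sh_ve e = ren_e e Suc id"
  "sh_m M = ren M id Suc" "sh_me e = ren_e e id Suc"
  by (simp_all add: lift_v_ren lift_m_ren)

lemma psub_apps [simp]:
  "psub (apps M s) \<sigma> \<theta> \<kappa> = apps (psub M \<sigma> \<theta> \<kappa>) (map (\<lambda>e. psub_e e \<sigma> \<theta> \<kappa>) s)"
  by (induction s arbitrary: M) simp_all

lemma ren_apps [simp]:
  "ren (apps M s) \<rho> \<theta> = apps (ren M \<rho> \<theta>) (map (\<lambda>e. ren_e e \<rho> \<theta>) s)"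
  by (induction s arbitrary: M) simp_all

text \<open>With variables for terms and empty stacks, \<open>psub\<close> only renames; facts about
  \<open>psub\<close> thus specialize to \<open>ren\<close>, as in \<open>ren_ren\<close> and
  \<open>red_ren\<close>.\<close>

lemma ren_psub_Var:
  "ren M \<rho> \<theta> = psub M (\<lambda>x. Var (\<rho> x)) \<theta> (\<lambda>_. [])"
  "ren_e e \<rho> \<theta> = psub_e e (\<lambda>x. Var (\<rho> x)) \<theta> (\<lambda>_. [])"
proof -
  have "up_v (\<lambda>x. Var (\<rho> x)) = (\<lambda>x. Var (up_ren \<rho> x))" "up_m (\<lambda>_. []) = (\<lambda>_. [])" for \<rho>
    by (auto simp: up_v_def up_m_def up_ren_def fun_eq_iff split: nat.split)
  then show "ren M \<rho> \<theta> = psub M (\<lambda>x. Var (\<rho> x)) \<theta> (\<lambda>_. [])"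
    "ren_e e \<rho> \<theta> = psub_e e (\<lambda>x. Var (\<rho> x)) \<theta> (\<lambda>_. [])"
    by (induction M and e arbitrary: \<rho> \<theta> and \<rho> \<theta>) simp_all
qed

lemma psub_ren:
  "psub (ren M \<rho> \<theta>') \<sigma> \<theta> \<kappa> = psub M (\<lambda>x. \<sigma> (\<rho> x)) (\<lambda>a. \<theta> (\<theta>' a)) (\<lambda>a. \<kappa> (\<theta>' a))"
  "psub_e (ren_e e \<rho> \<theta>') \<sigma> \<theta> \<kappa> = psub_e e (\<lambda>x. \<sigma> (\<rho> x)) (\<lambda>a. \<theta> (\<theta>' a)) (\<lambda>a. \<kappa> (\<theta>' a))"
proof -
  have "(\<lambda>x. up_v \<sigma> (up_ren \<rho> x)) = up_v (\<lambda>x. \<sigma> (\<rho> x))"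
    "(\<lambda>x. up_m \<kappa> (up_ren \<rho> x)) = up_m (\<lambda>x. \<kappa> (\<rho> x))"
    "(\<lambda>x. up_ren \<theta> (up_ren \<rho> x)) = up_ren (\<lambda>x. \<theta> (\<rho> x))" for \<sigma> \<kappa> \<theta> \<rho>
    by (auto simp: up_v_def up_m_def up_ren_def fun_eq_iff split: nat.split)
  then show
    "psub (ren M \<rho> \<theta>') \<sigma> \<theta> \<kappa> = psub M (\<lambda>x. \<sigma> (\<rho> x)) (\<lambda>a. \<theta> (\<theta>' a)) (\<lambda>a. \<kappa> (\<theta>' a))"
    "psub_e (ren_e e \<rho> \<theta>') \<sigma> \<theta> \<kappa> = psub_e e (\<lambda>x. \<sigma> (\<rho> x)) (\<lambda>a. \<theta> (\<theta>' a)) (\<lambda>a. \<kappa> (\<theta>' a))"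
    by (induction M and e arbitrary: \<rho> \<theta>' \<sigma> \<theta> \<kappa> and \<rho> \<theta>' \<sigma> \<theta> \<kappa>) simp_all
qed

lemma ren_ren:
  "ren (ren M \<rho> \<theta>) \<rho>' \<theta>' = ren M (\<lambda>x. \<rho>' (\<rho> x)) (\<lambda>a. \<theta>' (\<theta> a))"
  "ren_e (ren_e e \<rho> \<theta>) \<rho>' \<theta>' = ren_e e (\<lambda>x. \<rho>' (\<rho> x)) (\<lambda>a. \<theta>' (\<theta> a))"
  by (simp_all add: ren_psub_Var(1)[of _ \<rho>'] ren_psub_Var(2)[of _ \<rho>'] psub_ren)
    (simp_all add: ren_psub_Var)

lemma ren_psub:
  "ren (psub M \<sigma> \<theta> \<kappa>) \<rho> \<theta>' =
    psub M (\<lambda>x. ren (\<sigma> x) \<rho> \<theta>') (\<lambda>a. \<theta>' (\<theta> a)) (\<lambda>a. map (\<lambda>e. ren_e e \<rho> \<theta>') (\<kappa> a))"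
  "ren_e (psub_e e \<sigma> \<theta> \<kappa>) \<rho> \<theta>' =
    psub_e e (\<lambda>x. ren (\<sigma> x) \<rho> \<theta>') (\<lambda>a. \<theta>' (\<theta> a)) (\<lambda>a. map (\<lambda>e. ren_e e \<rho> \<theta>') (\<kappa> a))"
proof -
  have *: "(\<lambda>x. ren (up_v \<sigma> x) (up_ren \<rho>) \<theta>') = up_v (\<lambda>x. ren (\<sigma> x) \<rho> \<theta>')"
    "(\<lambda>a. map (\<lambda>e. ren_e e \<rho> (up_ren \<theta>')) (up_m \<kappa> a)) = up_m (\<lambda>a. map (\<lambda>e. ren_e e \<rho> \<theta>') (\<kappa> a))"
    "(\<lambda>x. up_ren \<theta>' (up_ren \<theta> x)) = up_ren (\<lambda>x. \<theta>' (\<theta> x))"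
    "ren_e (sh_ve e) (up_ren \<rho>) \<theta>' = sh_ve (ren_e e \<rho> \<theta>')"
    "ren (sh_m M) \<rho> (up_ren \<theta>') = sh_m (ren M \<rho> \<theta>')" for \<sigma> \<kappa> \<rho> \<theta> \<theta>' e M
    by (auto simp: up_v_def up_m_def up_ren_def fun_eq_iff shift_ren ren_ren split: nat.split)
  show "ren (psub M \<sigma> \<theta> \<kappa>) \<rho> \<theta>' =
    psub M (\<lambda>x. ren (\<sigma> x) \<rho> \<theta>') (\<lambda>a. \<theta>' (\<theta> a)) (\<lambda>a. map (\<lambda>e. ren_e e \<rho> \<theta>') (\<kappa> a))"
  "ren_e (psub_e e \<sigma> \<theta> \<kappa>) \<rho> \<theta>' =
    psub_e e (\<lambda>x. ren (\<sigma> x) \<rho> \<theta>') (\<lambda>a. \<theta>' (\<theta> a)) (\<lambda>a. map (\<lambda>e. ren_e e \<rho> \<theta>') (\<kappa> a))"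
    by (induction M and e arbitrary: \<rho> \<theta>' \<sigma> \<theta> \<kappa> and \<rho> \<theta>' \<sigma> \<theta> \<kappa>) (simp_all add: * comp_def)
qed

lemma psub_shift:
  "psub (sh_v M) (up_v \<sigma>) \<theta> (\<lambda>a. map sh_ve (\<kappa> a)) = sh_v (psub M \<sigma> \<theta> \<kappa>)"
  "psub_e (sh_ve e) (up_v \<sigma>) \<theta> (\<lambda>a. map sh_ve (\<kappa> a)) = sh_ve (psub_e e \<sigma> \<theta> \<kappa>)"
  "psub (sh_m M) (\<lambda>x. sh_m (\<sigma> x)) (up_ren \<theta>) (up_m \<kappa>) = sh_m (psub M \<sigma> \<theta> \<kappa>)"
  "psub_e (sh_me e) (\<lambda>x. sh_m (\<sigma> x)) (up_ren \<theta>) (up_m \<kappa>) = sh_me (psub_e e \<sigma> \<theta> \<kappa>)"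
  by (simp_all add: shift_ren psub_ren ren_psub up_v_def up_ren_def up_m_def)

text \<open>In \<open>Nam a L\<close> the first substitution puts \<open>\<kappa> a\<close> behind
  \<open>L\<close>. The second one acts on that stack, and the renamed variable
  \<open>\<theta> a\<close> then contributes its own stack further out, whence the order of the
  concatenation.\<close>

lemma psub_psub:
  "psub (psub M \<sigma> \<theta> \<kappa>) \<sigma>' \<theta>' \<kappa>' = psub M (\<lambda>x. psub (\<sigma> x) \<sigma>' \<theta>' \<kappa>') (\<lambda>a. \<theta>' (\<theta> a))
     (\<lambda>a. map (\<lambda>e. psub_e e \<sigma>' \<theta>' \<kappa>') (\<kappa> a) @ \<kappa>' (\<theta> a))"
  "psub_e (psub_e e \<sigma> \<theta> \<kappa>) \<sigma>' \<theta>' \<kappa>' = psub_e e (\<lambda>x. psub (\<sigma> x) \<sigma>' \<theta>' \<kappa>') (\<lambda>a. \<theta>' (\<theta> a))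
     (\<lambda>a. map (\<lambda>e. psub_e e \<sigma>' \<theta>' \<kappa>') (\<kappa> a) @ \<kappa>' (\<theta> a))"
proof -
  have *: "(\<lambda>x. psub (up_v \<sigma> x) (up_v \<sigma>') \<theta>' (\<lambda>a. map sh_ve (\<kappa>' a))) = up_v (\<lambda>x. psub (\<sigma> x) \<sigma>' \<theta>' \<kappa>')"
    "(\<lambda>a. map (\<lambda>e. psub_e e (\<lambda>x. sh_m (\<sigma>' x)) (up_ren \<theta>') (up_m \<kappa>')) (up_m \<kappa> a) @ up_m \<kappa>' (up_ren \<theta> a)) =
      up_m (\<lambda>a. map (\<lambda>e. psub_e e \<sigma>' \<theta>' \<kappa>') (\<kappa> a) @ \<kappa>' (\<theta> a))"
    "(\<lambda>x. up_ren \<theta>' (up_ren \<theta> x)) = up_ren (\<lambda>x. \<theta>' (\<theta> x))"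
    for \<sigma> \<sigma>' \<theta> \<theta>' \<kappa> \<kappa>'
      apply (auto simp: up_v_def fun_eq_iff psub_shift[unfolded up_v_def] split: nat.split)[1]
     apply (auto simp: up_m_def up_ren_def fun_eq_iff psub_shift[unfolded up_m_def up_ren_def] split: nat.split)[1]
    apply (auto simp: up_ren_def fun_eq_iff split: nat.split)[1]
    done
  show "psub (psub M \<sigma> \<theta> \<kappa>) \<sigma>' \<theta>' \<kappa>' = psub M (\<lambda>x. psub (\<sigma> x) \<sigma>' \<theta>' \<kappa>') (\<lambda>a. \<theta>' (\<theta> a))
     (\<lambda>a. map (\<lambda>e. psub_e e \<sigma>' \<theta>' \<kappa>') (\<kappa> a) @ \<kappa>' (\<theta> a))"
  "psub_e (psub_e e \<sigma> \<theta> \<kappa>) \<sigma>' \<theta>' \<kappa>' = psub_e e (\<lambda>x. psub (\<sigma> x) \<sigma>' \<theta>' \<kappa>') (\<lambda>a. \<theta>' (\<theta> a))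
     (\<lambda>a. map (\<lambda>e. psub_e e \<sigma>' \<theta>' \<kappa>') (\<kappa> a) @ \<kappa>' (\<theta> a))"
    by (induction M and e arbitrary: \<sigma> \<theta> \<kappa> \<sigma>' \<theta>' \<kappa>' and \<sigma> \<theta> \<kappa> \<sigma>' \<theta>' \<kappa>')
      (simp_all add: * psub_shift comp_def)
qed

lemma psub_id [simp]:
  "psub M Var (\<lambda>a. a) (\<lambda>_. []) = M" "psub_e e Var (\<lambda>a. a) (\<lambda>_. []) = e"
proof -
  have "up_v Var = Var" "up_m (\<lambda>_. []) = (\<lambda>_. [])" "up_ren (\<lambda>a. a) = (\<lambda>a. a)"
    by (auto simp: up_v_def up_m_def up_ren_def fun_eq_iff split: nat.split)
  then show "psub M Var (\<lambda>a. a) (\<lambda>_. []) = M" "psub_e e Var (\<lambda>a. a) (\<lambda>_. []) = e"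
    by (induction M and e) simp_all
qed

section \<open>The substitutions of the reduction rules as instances of \<open>psub\<close>\<close>

lemma subst_psub:
  "subst M N k = psub M (\<lambda>x. if x < k then Var x else if x = k then N else Var (x - 1)) (\<lambda>a. a) (\<lambda>_. [])"
  "subst_e e N k = psub_e e (\<lambda>x. if x < k then Var x else if x = k then N else Var (x - 1)) (\<lambda>a. a) (\<lambda>_. [])"
proof -
  have "up_v (\<lambda>x. if x < k then Var x else if x = k then N else Var (x - 1)) =
      (\<lambda>x. if x < Suc k then Var x else if x = Suc k then sh_v N else Var (x - 1))"
    "up_m (\<lambda>_. []) = (\<lambda>_. [])" "up_ren (\<lambda>a. a) = (\<lambda>a. a)"
    "(\<lambda>x. sh_m (if x < k then Var x else if x = k then N else Var (x - 1))) =
      (\<lambda>x. if x < k then Var x else if x = k then sh_m N else Var (x - 1))" for k N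
    by (auto simp: up_v_def up_m_def up_ren_def fun_eq_iff split: nat.split)
  then show
    "subst M N k = psub M (\<lambda>x. if x < k then Var x else if x = k then N else Var (x - 1)) (\<lambda>a. a) (\<lambda>_. [])"
    "subst_e e N k = psub_e e (\<lambda>x. if x < k then Var x else if x = k then N else Var (x - 1)) (\<lambda>a. a) (\<lambda>_. [])"
    by (induction M and e arbitrary: k N and k N) simp_all
qed

lemma subst0_psub: "subst M N 0 = psub M (case_nat N Var) (\<lambda>a. a) (\<lambda>_. [])"
proof -
  have "(\<lambda>x. if x < 0 then Var x else if x = 0 then N else Var (x - 1)) = case_nat N Var"
    by (auto simp: fun_eq_iff split: nat.split)
  then show ?thesis
    by (simp only: subst_psub)
qed

lemma msubst_psub:
  "msubst M d a = psub M Var (\<lambda>a. a) (\<lambda>b. if b = a then [d] else [])"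
  "msubst_e e d a = psub_e e Var (\<lambda>a. a) (\<lambda>b. if b = a then [d] else [])"
proof -
  have "up_v Var = Var" "up_ren (\<lambda>a. a) = (\<lambda>a. a)"
    "(\<lambda>b. map sh_ve (if b = a then [d] else [])) = (\<lambda>b. if b = a then [sh_ve d] else [])"
    "up_m (\<lambda>b. if b = a then [d] else []) = (\<lambda>b. if b = Suc a then [sh_me d] else [])" for a d
    by (auto simp: up_v_def up_m_def up_ren_def fun_eq_iff split: nat.split)
  then show
    "msubst M d a = psub M Var (\<lambda>a. a) (\<lambda>b. if b = a then [d] else [])"
    "msubst_e e d a = psub_e e Var (\<lambda>a. a) (\<lambda>b. if b = a then [d] else [])"
    by (induction M and e arbitrary: a d and a d) simp_all
qed

text \<open>The effect of \<open>(\<mu>\<alpha>.M)\<close> consuming the whole sequence \<open>s\<close> of eliminators.\<close>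

definition msub0 :: "trm \<Rightarrow> elim list \<Rightarrow> trm" where
  "msub0 M s = psub M Var (\<lambda>a. a) (case_nat (map sh_me s) (\<lambda>_. []))"

lemma msubst0: "msubst M (sh_me e) 0 = msub0 M [e]"
proof -
  have "(\<lambda>b. if b = 0 then [sh_me e] else []) = case_nat (map sh_me [e]) (\<lambda>_. [])"
    by (auto simp: fun_eq_iff split: nat.split)
  then show ?thesis
    by (simp only: msubst_psub msub0_def)
qed

lemma psub_subst0:
  "psub (subst M N 0) \<sigma> \<theta> \<kappa> = subst (psub M (up_v \<sigma>) \<theta> (\<lambda>a. map sh_ve (\<kappa> a))) (psub N \<sigma> \<theta> \<kappa>) 0"
proof -
  have "psub_e (sh_ve e) (case_nat P Var) (\<lambda>a. a) (\<lambda>_. []) = e"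
    "psub (sh_v M) (case_nat P Var) (\<lambda>a. a) (\<lambda>_. []) = M" for e M P
    by (simp_all add: shift_ren psub_ren)
  then show ?thesis
    by (auto simp: subst0_psub psub_psub comp_def up_v_def split: nat.split
        intro!: arg_cong[where f = "\<lambda>f. psub M f \<theta> \<kappa>"])
qed

text \<open>A substitution moved under a \<mu>-binder fixes index 0 and adds no stack to it, so it
  only acts on the elements of \<open>s\<close>. Conversely, the terms and stacks it inserts are
  shifted and escape the replacement at index 0.\<close>

lemma psub_msub0:
  "psub (msub0 M s) (\<lambda>x. sh_m (\<sigma> x)) (up_ren \<theta>) (up_m \<kappa>) =
   msub0 (psub M (\<lambda>x. sh_m (\<sigma> x)) (up_ren \<theta>) (up_m \<kappa>)) (map (\<lambda>e. psub_e e \<sigma> \<theta> \<kappa>) s)"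
proof -
  have "psub_e (sh_me e) Var (\<lambda>a. a) (case_nat t (\<lambda>_. [])) = sh_me e"
    "psub (sh_m M) Var (\<lambda>a. a) (case_nat t (\<lambda>_. [])) = sh_m M" for e M t
    by (simp_all add: shift_ren psub_ren) (simp_all add: ren_psub_Var)
  then have "(\<lambda>a. map (\<lambda>e. psub_e e (\<lambda>x. sh_m (\<sigma> x)) (up_ren \<theta>) (up_m \<kappa>)) (case_nat (map sh_me s) (\<lambda>_. []) a) @ up_m \<kappa> a) =
    (\<lambda>a. map (\<lambda>e. psub_e e Var (\<lambda>a. a) (case_nat (map sh_me (map (\<lambda>e. psub_e e \<sigma> \<theta> \<kappa>) s)) (\<lambda>_. []))) (up_m \<kappa> a) @
       case_nat (map sh_me (map (\<lambda>e. psub_e e \<sigma> \<theta> \<kappa>) s)) (\<lambda>_. []) (up_ren \<theta> a))"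
    and "(\<lambda>x. psub (sh_m (\<sigma> x)) Var (\<lambda>a. a) (case_nat (map sh_me (map (\<lambda>e. psub_e e \<sigma> \<theta> \<kappa>) s)) (\<lambda>_. []))) = (\<lambda>x. sh_m (\<sigma> x))"
    by (auto simp: fun_eq_iff psub_shift comp_def up_m_def[of \<kappa>] up_ren_def[of \<theta>] split: nat.split)
       (auto simp: up_m_def[symmetric] up_ren_def[symmetric] psub_shift)
  then show ?thesis
    by (simp only: msub0_def psub_psub psub.simps)
qed

text \<open>The shifted \<open>e\<close> contains no free index 0, so the second pass keeps it and
  appends \<open>s\<close> behind it. Hence a \<mu> may consume a stack step by step or all at
  once.\<close>

lemma msub0_Cons: "msub0 (msub0 M [e]) s = msub0 M (e # s)"
proof -
  have "psub_e (sh_me e) Var (\<lambda>a. a) (case_nat t (\<lambda>_. [])) = sh_me e" for e t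
    by (simp_all add: shift_ren psub_ren) (simp_all add: ren_psub_Var)
  then show ?thesis
    by (auto simp: msub0_def psub_psub split: nat.split
        intro!: arg_cong[where f = "psub M Var (\<lambda>a. a)"])
qed

section \<open>Reduction, stacks and substitution\<close>

text \<open>These are the steps of \<open>apps M s\<close> that are available whatever
  \<open>M\<close> is. A permutation is among them when the \<open>Case\<close> and the eliminator
  after it both lie in the stack.\<close>

inductive sred :: "elim list \<Rightarrow> elim list \<Rightarrow> bool" where
  sred_head: "e \<triangleright>\<^sub>e e' \<Longrightarrow> sred (e # s) (e' # s)"
| sred_perm: "sred (Case N1 N2 # e # s) (Case (App N1 (sh_ve e)) (App N2 (sh_ve e)) # s)"
| sred_tail: "sred s s' \<Longrightarrow> sred (e # s) (e # s')"

lemma red_apps: "M \<triangleright> M' \<Longrightarrow> apps M s \<triangleright> apps M' s"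
  by (induction s arbitrary: M M') (simp_all add: red_red_e.AppL)

lemma sred_apps: "sred s s' \<Longrightarrow> apps M s \<triangleright> apps M s'"
  by (induction arbitrary: M rule: sred.induct) (auto intro: red_red_e.intros red_apps)

text \<open>The \<mu>-rule is phrased through \<open>msub0\<close>, so that successive \<mu>-steps
  compose by \<open>msub0_Cons\<close>.\<close>

inductive root :: "trm \<Rightarrow> elim \<Rightarrow> trm \<Rightarrow> bool" where
  "root (Lam M) (Arg N) (subst M N 0)"
| "root (Mu M) e (Mu (msub0 M [e]))"
| "root (Pair M1 M2) Proj1 M1"
| "root (Pair M1 M2) Proj2 M2"
| "root (Inj1 M) (Case N1 N2) (subst N1 M 0)"
| "root (Inj2 M) (Case N1 N2) (subst N2 M 0)"
| "root (App M (Case N1 N2)) e (App M (Case (App N1 (sh_ve e)) (App N2 (sh_ve e))))"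

lemma red_AppE:
  assumes "App M e \<triangleright> T"
  obtains (root) "root M e T"
  | (left) M' where "M \<triangleright> M'" "T = App M' e"
  | (right) e' where "e \<triangleright>\<^sub>e e'" "T = App M e'"
  using assms by (cases rule: red.cases) (auto simp: msubst0 intro: root.intros)

text \<open>Peeling the stack from the head, a redex at the root of an application either involves
  \<open>H\<close> itself or lies between two neighbouring eliminators, where it can only be a
  permutation.\<close>

lemma red_apps_cases:
  assumes "apps H s \<triangleright> T"
  shows "(\<exists>H'. H \<triangleright> H' \<and> T = apps H' s) \<or> (\<exists>s'. sred s s' \<and> T = apps H s') \<or>
    (\<exists>e s' P. s = e # s' \<and> root H e P \<and> T = apps P s')"
  using assms
proof (induction s arbitrary: H)
  case (Cons e s)
  from Cons.prems have "apps (App H e) s \<triangleright> T" by simp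
  from Cons.IH[OF this] show ?case
  proof (elim disjE exE conjE)
    fix H' assume "App H e \<triangleright> H'" and T: "T = apps H' s"
    from this(1) show ?thesis
    proof (cases rule: red_AppE)
      case root
      then show ?thesis using T by blast
    next
      case (left M')
      then show ?thesis using T by auto
    next
      case (right e')
      then have "sred (e # s) (e' # s)" "T = apps H (e' # s)" using T by (auto intro: sred_head)
      then show ?thesis by blast
    qed
  next
    fix s' assume "sred s s'" "T = apps (App H e) s'"
    then have "sred (e # s) (e # s')" "T = apps H (e # s')" by (auto intro: sred_tail)
    then show ?thesis by blast
  next
    fix e2 s2 P assume s: "s = e2 # s2" and r: "root (App H e) e2 P" and T: "T = apps P s2"
    \<comment> \<open>The head \<open>App H e\<close> is an application, so only the permutation
      applies: \<open>e\<close> is a \<open>Case\<close>, and the step already belongs to the stack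
      \<open>e # s\<close>.\<close>
    from r obtain N1 N2 where "e = Case N1 N2" "P = App H (Case (App N1 (sh_ve e2)) (App N2 (sh_ve e2)))"
      by (cases rule: root.cases) auto
    then have "sred (e # s) (Case (App N1 (sh_ve e2)) (App N2 (sh_ve e2)) # s2)"
      "T = apps H (Case (App N1 (sh_ve e2)) (App N2 (sh_ve e2)) # s2)"
      using s T by (auto intro: sred_perm)
    then show ?thesis by blast
  qed
qed simp

lemma red_appsE:
  assumes "apps H s \<triangleright> T"
  obtains (head) H' where "H \<triangleright> H'" "T = apps H' s"
  | (stack) s' where "sred s s'" "T = apps H s'"
  | (root) e s' P where "s = e # s'" "root H e P" "T = apps P s'"
  using red_apps_cases[OF assms] by blast

section \<open>Compatibility of reduction with substitution\<close>

text \<open>Substitution keeps each redex of \<open>M\<close> and neither copies nor erases it, so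
  one step gives exactly one step. This strictness is what makes strong normalization reflect along
  \<open>psub\<close> in \<open>SN_psub\<close>.\<close>

lemma red_psub:
  "M \<triangleright> M' \<Longrightarrow> psub M \<sigma> \<theta> \<kappa> \<triangleright> psub M' \<sigma> \<theta> \<kappa>"
  "e \<triangleright>\<^sub>e e' \<Longrightarrow> psub_e e \<sigma> \<theta> \<kappa> \<triangleright>\<^sub>e psub_e e' \<sigma> \<theta> \<kappa>"
proof (induction arbitrary: \<sigma> \<theta> \<kappa> and \<sigma> \<theta> \<kappa> rule: red_red_e.inducts)
  case (mu M e)
  show ?case
    using red_red_e.mu[of "psub M (\<lambda>x. sh_m (\<sigma> x)) (up_ren \<theta>) (up_m \<kappa>)" "psub_e e \<sigma> \<theta> \<kappa>"]
    by (simp add: msubst0 psub_msub0)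
next
  case (Nam M M' a)
  then show ?case by (simp add: red_red_e.Nam red_apps)
qed (auto simp: psub_subst0 psub_shift intro: red_red_e.intros)

lemma red_ren: "M \<triangleright> M' \<Longrightarrow> ren M \<rho> \<theta> \<triangleright> ren M' \<rho> \<theta>" "e \<triangleright>\<^sub>e e' \<Longrightarrow> ren_e e \<rho> \<theta> \<triangleright>\<^sub>e ren_e e' \<rho> \<theta>"
  by (simp_all add: ren_psub_Var red_psub)

lemma sred_psub: "sred s s' \<Longrightarrow> sred (map (\<lambda>e. psub_e e \<sigma> \<theta> \<kappa>) s) (map (\<lambda>e. psub_e e \<sigma> \<theta> \<kappa>) s')"
  by (induction rule: sred.induct) (auto simp: psub_shift intro: sred.intros red_psub)

lemma sred_shift: "sred s s' \<Longrightarrow> sred (map sh_ve s) (map sh_ve s')" "sred s s' \<Longrightarrow> sred (map sh_me s) (map sh_me s')"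
  by (simp_all only: shift_ren ren_psub_Var sred_psub)

lemma rtranclp_map: "R\<^sup>*\<^sup>* x y \<Longrightarrow> (\<And>x y. R x y \<Longrightarrow> S (f x) (f y)) \<Longrightarrow> S\<^sup>*\<^sup>* (f x) (f y)"
  by (induction rule: rtranclp_induct) (auto intro: rtranclp.rtrancl_into_rtrancl)

lemma reds_cong1:
  "red\<^sup>*\<^sup>* M M' \<Longrightarrow> red\<^sup>*\<^sup>* (Lam M) (Lam M')"
  "red\<^sup>*\<^sup>* M M' \<Longrightarrow> red\<^sup>*\<^sup>* (Inj1 M) (Inj1 M')"
  "red\<^sup>*\<^sup>* M M' \<Longrightarrow> red\<^sup>*\<^sup>* (Inj2 M) (Inj2 M')"
  "red\<^sup>*\<^sup>* M M' \<Longrightarrow> red\<^sup>*\<^sup>* (Mu M) (Mu M')"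
  "red\<^sup>*\<^sup>* M M' \<Longrightarrow> red\<^sup>*\<^sup>* (Nam a M) (Nam a M')"
  "red\<^sup>*\<^sup>* M M' \<Longrightarrow> red_e\<^sup>*\<^sup>* (Arg M) (Arg M')"
  by (erule rtranclp_map, erule red_red_e.intros)+

lemma reds_cong2:
  "red\<^sup>*\<^sup>* M M' \<Longrightarrow> red_e\<^sup>*\<^sup>* e e' \<Longrightarrow> red\<^sup>*\<^sup>* (App M e) (App M' e')"
  "red\<^sup>*\<^sup>* M M' \<Longrightarrow> red\<^sup>*\<^sup>* N N' \<Longrightarrow> red\<^sup>*\<^sup>* (Pair M N) (Pair M' N')"
  "red\<^sup>*\<^sup>* M M' \<Longrightarrow> red\<^sup>*\<^sup>* N N' \<Longrightarrow> red_e\<^sup>*\<^sup>* (Case M N) (Case M' N')"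
  "red\<^sup>*\<^sup>* M M' \<Longrightarrow> sred\<^sup>*\<^sup>* s s' \<Longrightarrow> red\<^sup>*\<^sup>* (apps M s) (apps M' s')"
     apply (rule rtranclp_trans[OF rtranclp_map[where f = "\<lambda>M. App M e"] rtranclp_map[where f = "App M'"]])
        apply (assumption | erule red_red_e.intros)+
    apply (rule rtranclp_trans[OF rtranclp_map[where f = "\<lambda>M. Pair M N"] rtranclp_map[where f = "Pair M'"]])
       apply (assumption | erule red_red_e.intros)+
   apply (rule rtranclp_trans[OF rtranclp_map[where f = "\<lambda>M. Case M N"] rtranclp_map[where f = "Case M'"]])
      apply (assumption | erule red_red_e.intros)+
  apply (rule rtranclp_trans[OF rtranclp_map[where f = "\<lambda>M. apps M s"] rtranclp_map[where f = "apps M'"]])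
     apply (assumption | erule red_apps sred_apps)+
  done

lemmas reds_cong = reds_cong1 reds_cong2

text \<open>The inserted terms and stacks may be copied or erased, so a step in them becomes zero or
  more steps of the result.\<close>

lemma reds_psub:
  "\<lbrakk>\<And>x. red\<^sup>*\<^sup>* (\<sigma> x) (\<sigma>' x); \<And>a. sred\<^sup>*\<^sup>* (\<kappa> a) (\<kappa>' a)\<rbrakk> \<Longrightarrow> red\<^sup>*\<^sup>* (psub M \<sigma> \<theta> \<kappa>) (psub M \<sigma>' \<theta> \<kappa>')"
  "\<lbrakk>\<And>x. red\<^sup>*\<^sup>* (\<sigma> x) (\<sigma>' x); \<And>a. sred\<^sup>*\<^sup>* (\<kappa> a) (\<kappa>' a)\<rbrakk> \<Longrightarrow> red_e\<^sup>*\<^sup>* (psub_e e \<sigma> \<theta> \<kappa>) (psub_e e \<sigma>' \<theta> \<kappa>')"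
proof (induction M and e arbitrary: \<sigma> \<theta> \<kappa> \<sigma>' \<kappa>' and \<sigma> \<theta> \<kappa> \<sigma>' \<kappa>')
  have sh: "red\<^sup>*\<^sup>* M M' \<Longrightarrow> red\<^sup>*\<^sup>* (sh_v M) (sh_v M')" "red\<^sup>*\<^sup>* M M' \<Longrightarrow> red\<^sup>*\<^sup>* (sh_m M) (sh_m M')"
    "sred\<^sup>*\<^sup>* s s' \<Longrightarrow> sred\<^sup>*\<^sup>* (map sh_ve s) (map sh_ve s')"
    "sred\<^sup>*\<^sup>* s s' \<Longrightarrow> sred\<^sup>*\<^sup>* (map sh_me s) (map sh_me s')" for M M' s s'
       apply (erule rtranclp_map, simp add: shift_ren red_ren)
      apply (erule rtranclp_map, simp add: shift_ren red_ren)
     apply (erule rtranclp_map, simp add: sred_shift)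
    apply (erule rtranclp_map, simp add: sred_shift)
    done
  have up: "red\<^sup>*\<^sup>* (up_v \<sigma> x) (up_v \<sigma>' x)" if "\<And>x. red\<^sup>*\<^sup>* (\<sigma> x) (\<sigma>' x)" for \<sigma> \<sigma>' x
    using that by (auto simp: up_v_def sh split: nat.split)
  have um: "sred\<^sup>*\<^sup>* (up_m \<kappa> x) (up_m \<kappa>' x)" if "\<And>x. sred\<^sup>*\<^sup>* (\<kappa> x) (\<kappa>' x)" for \<kappa> \<kappa>' x
    using that by (auto simp: up_m_def sh split: nat.split)
  {
    case (Lam M)
    show ?case unfolding psub.simps by (intro reds_cong Lam.IH up sh Lam.prems)
  next
    case (Case M N)
    show ?case unfolding psub_e.simps by (intro reds_cong Case.IH up sh Case.prems)
  next
    case (Mu M)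
    show ?case unfolding psub.simps by (intro reds_cong Mu.IH um sh Mu.prems)
  }
qed (auto intro!: reds_cong)

lemma reds_subst0: "N \<triangleright> N' \<Longrightarrow> red\<^sup>*\<^sup>* (subst M N 0) (subst M N' 0)"
  unfolding subst0_psub by (rule reds_psub) (auto split: nat.split)

lemma red_subst0: "M \<triangleright> M' \<Longrightarrow> subst M N 0 \<triangleright> subst M' N 0"
  unfolding subst0_psub by (rule red_psub)

lemma reds_msub0: "sred s s' \<Longrightarrow> red\<^sup>*\<^sup>* (msub0 M s) (msub0 M s')"
  unfolding msub0_def by (rule reds_psub) (auto split: nat.split intro: sred_shift)

lemma red_msub0: "M \<triangleright> M' \<Longrightarrow> msub0 M s \<triangleright> msub0 M' s"
  unfolding msub0_def by (rule red_psub)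

section \<open>Strong normalization of head expansions\<close>

abbreviation SN :: "trm \<Rightarrow> bool" where
  "SN \<equiv> Wellfounded.accp (\<lambda>N M. M \<triangleright> N)"

abbreviation SN_e :: "elim \<Rightarrow> bool" where
  "SN_e \<equiv> Wellfounded.accp (\<lambda>d e. e \<triangleright>\<^sub>e d)"

lemma SN_I: "(\<And>N. M \<triangleright> N \<Longrightarrow> SN N) \<Longrightarrow> SN M"
  by (rule accp.accI)

lemma SN_red: "SN M \<Longrightarrow> M \<triangleright> N \<Longrightarrow> SN N"
  by (rule accp_downward)

lemma SN_reds: "red\<^sup>*\<^sup>* M N \<Longrightarrow> SN M \<Longrightarrow> SN N"
  by (induction rule: rtranclp_induct) (auto intro: SN_red)

lemma accp_inv_image:
  assumes "Wellfounded.accp (\<lambda>y x. S x y) (f x)" and "\<And>x y. R x y \<Longrightarrow> S (f x) (f y)"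
  shows "Wellfounded.accp (\<lambda>y x. R x y) x"
  using assms(1)
proof (induction "f x" arbitrary: x rule: accp_induct_rule)
  case 1
  then show ?case by (auto intro: accp.accI assms(2))
qed

text \<open>By \<open>red_psub\<close>, an infinite reduction of \<open>M\<close> would yield one of
  the instance.\<close>

lemma SN_psub: "SN (psub M \<sigma> \<theta> \<kappa>) \<Longrightarrow> SN M"
  by (erule accp_inv_image[where f = "\<lambda>M. psub M \<sigma> \<theta> \<kappa>"]) (rule red_psub)

inductive_cases red_VarE: "Var x \<triangleright> T"
inductive_cases red_LamE: "Lam M \<triangleright> T"
inductive_cases red_PairE: "Pair M N \<triangleright> T"
inductive_cases red_Inj1E: "Inj1 M \<triangleright> T"
inductive_cases red_Inj2E: "Inj2 M \<triangleright> T"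
inductive_cases red_MuE: "Mu M \<triangleright> T"
inductive_cases red_NamE: "Nam a M \<triangleright> T"
inductive_cases red_ArgE: "Arg M \<triangleright>\<^sub>e e"
inductive_cases red_Proj1E: "Proj1 \<triangleright>\<^sub>e e"
inductive_cases red_Proj2E: "Proj2 \<triangleright>\<^sub>e e"
inductive_cases red_CaseE: "Case M N \<triangleright>\<^sub>e e"

lemmas redEs = red_VarE red_LamE red_PairE red_Inj1E red_Inj2E red_MuE red_NamE
  red_ArgE red_Proj1E red_Proj2E red_CaseE

section \<open>Head expansion for abstractions and pairs\<close>

text \<open>Steps in \<open>M\<close> and \<open>s\<close> are visible in the contractum and are
  handled by the inner induction. A step in \<open>N\<close> may disappear when \<open>M\<close>
  does not use its variable, so \<open>N\<close> carries the outer induction.\<close>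

lemma SN_beta:
  assumes "SN N" and "SN (apps (subst M N 0) s)"
  shows "SN (apps (Lam M) (Arg N # s))"
  using assms
proof (induction arbitrary: M s rule: accp_induct_rule)
  case (1 N)
  from 1(3) show ?case
  proof (induction "apps (subst M N 0) s" arbitrary: M s rule: accp_induct_rule)
    case inner: 1
    have sn: "SN (apps (subst M N 0) s)" by (rule inner(1))
    have "SN T" if "apps (App (Lam M) (Arg N)) s \<triangleright> T" for T
      using that
    proof (cases rule: red_appsE)
      case (head H')
      from head(1) show ?thesis
      proof (cases rule: red_AppE)
        case root
        then show ?thesis using sn head by (auto elim!: root.cases)
      next
        case (left L)
        then obtain M' where "M \<triangleright> M'" "L = Lam M'" by (auto elim: red_LamE)
        then show ?thesis using inner(2)[of M' s] left head by (auto intro: red_apps red_subst0)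
      next
        case (right e')
        then obtain N' where N': "N \<triangleright> N'" "e' = Arg N'" by (auto elim: red_ArgE)
        then have "red\<^sup>*\<^sup>* (apps (subst M N 0) s) (apps (subst M N' 0) s)"
          by (simp add: reds_cong reds_subst0)
        then show ?thesis using sn 1(2)[of N' M s] N' right head by (simp add: SN_reds)
      qed
    next
      case (stack s')
      then show ?thesis using inner(2)[of M s'] by (auto intro: sred_apps)
    next
      case (root e s' P)
      then show ?thesis by (auto elim: root.cases)
    qed
    then show ?case unfolding apps_simps by (rule SN_I)
  qed
qed

text \<open>The contractum has lost \<open>N\<close>; its reductions are therefore counted by a
  separate outer induction.\<close>

lemma SN_Proj1:
  assumes "SN N" "SN (apps M s)"
  shows "SN (apps (Pair M N) (Proj1 # s))"
  using assms
proof (induction arbitrary: M s rule: accp_induct_rule)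
  case N: (1 N)
  from N(3) show ?case
  proof (induction "apps M s" arbitrary: M s rule: accp_induct_rule)
    case inner: 1
    have "SN T" if "apps (App (Pair M N) Proj1) s \<triangleright> T" for T
      using that
    proof (cases rule: red_appsE)
      case (head H')
      from head(1) show ?thesis
      proof (cases rule: red_AppE)
        case root
        then have "H' = M" by (auto elim: root.cases)
        then show ?thesis using inner(1) head(2) by simp
      next
        case (left L)
        then consider M' where "M \<triangleright> M'" "L = Pair M' N" | N' where "N \<triangleright> N'" "L = Pair M N'"
          by (auto elim: red_PairE)
        then show ?thesis
        proof cases
          case (1 M')
          then show ?thesis using inner(2)[OF red_apps[OF 1(1)]] left(2) head(2) by simp
        next
          case (2 N')
          then show ?thesis using N(2)[OF 2(1) inner(1)] left(2) head(2) by simp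
        qed
      next
        case (right e')
        then show ?thesis by (auto elim: redEs)
      qed
    next
      case (stack s')
      then show ?thesis using inner(2)[OF sred_apps[OF stack(1)]] by simp
    next
      case (root e s' P)
      then show ?thesis by (auto elim: root.cases)
    qed
    then show ?case unfolding apps_simps by (rule SN_I)
  qed
qed

lemma SN_Proj2:
  assumes "SN N" "SN (apps M s)"
  shows "SN (apps (Pair N M) (Proj2 # s))"
  using assms
proof (induction arbitrary: M s rule: accp_induct_rule)
  case N: (1 N)
  from N(3) show ?case
  proof (induction "apps M s" arbitrary: M s rule: accp_induct_rule)
    case inner: 1
    have "SN T" if "apps (App (Pair N M) Proj2) s \<triangleright> T" for T
      using that
    proof (cases rule: red_appsE)
      case (head H')
      from head(1) show ?thesis
      proof (cases rule: red_AppE)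
        case root
        then have "H' = M" by (auto elim: root.cases)
        then show ?thesis using inner(1) head(2) by simp
      next
        case (left L)
        then consider M' where "M \<triangleright> M'" "L = Pair N M'" | N' where "N \<triangleright> N'" "L = Pair N' M"
          by (auto elim: red_PairE)
        then show ?thesis
        proof cases
          case (1 M')
          then show ?thesis using inner(2)[OF red_apps[OF 1(1)]] left(2) head(2) by simp
        next
          case (2 N')
          then show ?thesis using N(2)[OF 2(1) inner(1)] left(2) head(2) by simp
        qed
      next
        case (right e')
        then show ?thesis by (auto elim: redEs)
      qed
    next
      case (stack s')
      then show ?thesis using inner(2)[OF sred_apps[OF stack(1)]] by simp
    next
      case (root e s' P)
      then show ?thesis by (auto elim: root.cases)
    qed
    then show ?case unfolding apps_simps by (rule SN_I)
  qed
qed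

section \<open>Constructors, eliminators and variables in front of a stack\<close>

lemma SN_Pair:
  assumes "SN M" "SN N"
  shows "SN (Pair M N)"
  using assms
proof (induction arbitrary: N rule: accp_induct_rule)
  case (1 M)
  from 1(3) show ?case
  proof (induction rule: accp_induct_rule)
    case inner: (1 N)
    have N: "SN N" by (rule inner(1))
    show ?case by (rule SN_I) (auto elim!: red_PairE inner(2) 1(2)[OF _ N])
  qed
qed

lemma SN_Inj1: "SN M \<Longrightarrow> SN (Inj1 M)"
  by (induction rule: accp_induct_rule) (rule SN_I, auto elim!: redEs)

lemma SN_Inj2: "SN M \<Longrightarrow> SN (Inj2 M)"
  by (induction rule: accp_induct_rule) (rule SN_I, auto elim!: redEs)

lemma SN_Lam: "SN M \<Longrightarrow> SN (Lam M)"
  by (induction rule: accp_induct_rule) (rule SN_I, auto elim!: redEs)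

lemma SN_Nam: "SN M \<Longrightarrow> SN (Nam a M)"
  by (induction rule: accp_induct_rule) (rule SN_I, auto elim!: redEs)

lemma SN_Var: "SN (Var x)"
  by (rule SN_I) (auto elim!: redEs)

lemma SN_e_Arg: "SN M \<Longrightarrow> SN_e (Arg M)"
  by (induction rule: accp_induct_rule) (rule accp.accI, auto elim!: redEs)

lemma SN_e_Proj: "SN_e Proj1" "SN_e Proj2"
  by (rule accp.accI, auto elim!: redEs)+

text \<open>The variable forms no redex with \<open>e\<close>, and \<open>e\<close> never becomes a
  \<open>Case\<close>, so no permutation links \<open>e\<close> to \<open>s\<close>: the two reduce
  independently.\<close>

lemma SN_Var_apps:
  assumes "SN_e e" and "SN (apps (Var x) s)" and "\<And>N1 N2. e \<noteq> Case N1 N2"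
  shows "SN (apps (Var x) (e # s))"
  using assms
proof (induction arbitrary: s rule: accp_induct_rule)
  case (1 e)
  from 1(3) show ?case
  proof (induction "apps (Var x) s" arbitrary: s rule: accp_induct_rule)
    case inner: 1
    have sn: "SN (apps (Var x) s)" by (rule inner(1))
    have "SN T" if "apps (App (Var x) e) s \<triangleright> T" for T
      using that
    proof (cases rule: red_appsE)
      case (head H')
      from head(1) show ?thesis
      proof (cases rule: red_AppE)
        case root
        then show ?thesis by (auto elim: root.cases)
      next
        case (left L)
        then show ?thesis by (auto elim: redEs)
      next
        case (right e')
        moreover have "e' \<noteq> Case N1 N2" for N1 N2
          using \<open>e \<triangleright>\<^sub>e e'\<close> 1(4) by (auto elim: red_e.cases)
        ultimately show ?thesis using 1(2)[OF _ sn] head by auto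
      qed
    next
      case (stack s')
      then show ?thesis using inner(2)[of s'] by (auto intro: sred_apps)
    next
      case (root f s' P)
      then show ?thesis using 1(4) by (auto elim: root.cases)
    qed
    then show ?case unfolding apps_simps by (rule SN_I)
  qed
qed

section \<open>Case distinctions and permutative conversions\<close>

text \<open>An invariant for terms in front of a \<open>Case\<close>. No such term is an application
  or a \<mu>-abstraction, so the only contraction with the \<open>Case\<close> is that of an
  injection, whose contractum is recorded as strongly normalizing.\<close>

inductive case_head :: "trm \<Rightarrow> trm \<Rightarrow> trm \<Rightarrow> elim list \<Rightarrow> bool" where
  "case_head (Var x) N1 N2 s"
| "SN (apps (subst N1 M 0) s) \<Longrightarrow> case_head (Inj1 M) N1 N2 s"
| "SN (apps (subst N2 M 0) s) \<Longrightarrow> case_head (Inj2 M) N1 N2 s"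

lemma case_head_red: "case_head H N1 N2 s \<Longrightarrow> H \<triangleright> H' \<Longrightarrow> case_head H' N1 N2 s"
proof (induction rule: case_head.induct)
  case (2 N1 M s N2)
  then obtain M' where "M \<triangleright> M'" "H' = Inj1 M'" by (auto elim: redEs)
  then show ?case using 2(1) by (auto intro!: case_head.intros SN_reds[of "apps (subst N1 M 0) s"] reds_cong reds_subst0)
next
  case (3 N2 M s N1)
  then obtain M' where "M \<triangleright> M'" "H' = Inj2 M'" by (auto elim: redEs)
  then show ?case using 3(1) by (auto intro!: case_head.intros SN_reds[of "apps (subst N2 M 0) s"] reds_cong reds_subst0)
qed (auto elim: redEs)

lemma case_head_red_branch:
  "case_head H N1 N2 s \<Longrightarrow> N1 \<triangleright> N1' \<Longrightarrow> case_head H N1' N2 s"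
  "case_head H N1 N2 s \<Longrightarrow> N2 \<triangleright> N2' \<Longrightarrow> case_head H N1 N2' s"
  "case_head H N1 N2 s \<Longrightarrow> sred s s' \<Longrightarrow> case_head H N1 N2 s'"
  by (auto elim!: case_head.cases intro!: case_head.intros
      intro: SN_red[OF _ red_apps[OF red_subst0]] SN_red[OF _ sred_apps])

lemma subst_sh [simp]: "subst (sh_v M) N 0 = M" "subst_e (sh_ve e) N 0 = e"
  using psub_id by (simp_all add: subst_psub shift_ren psub_ren)

text \<open>Substitution cancels the shift of \<open>e\<close>, so the contractum in front of its
  stack is the same term before and after the permutation.\<close>

lemma case_head_perm:
  "case_head H N1 N2 (e # s) \<Longrightarrow> case_head H (App N1 (sh_ve e)) (App N2 (sh_ve e)) s"
  by (auto elim!: case_head.cases intro!: case_head.intros)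

text \<open>Lexicographic induction on the reductions of \<open>H\<close>, of \<open>Q1\<close>, of
  \<open>Q2\<close>, and on the length of \<open>s\<close>. A permutation absorbing the first
  element of \<open>s\<close> leaves \<open>Q1\<close> and \<open>Q2\<close> literally unchanged and
  shortens \<open>s\<close>. The equations for \<open>Q1\<close> and \<open>Q2\<close> allow
  induction on these terms while branches and stack vary.\<close>

lemma SN_case:
  assumes "SN H" and "SN Q1" and "SN Q2" and "case_head H N1 N2 s"
    and "Q1 = apps N1 (map sh_ve s)" and "Q2 = apps N2 (map sh_ve s)"
  shows "SN (apps H (Case N1 N2 # s))"
  using assms
proof (induction arbitrary: Q1 Q2 N1 N2 s rule: accp_induct_rule)
  case H: (1 H)
  from H(3-) show ?case
  proof (induction arbitrary: Q2 N1 N2 s rule: accp_induct_rule)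
    case Q1: (1 Q1)
    from Q1(3-) show ?case
    proof (induction arbitrary: N1 N2 s rule: accp_induct_rule)
      case Q2: (1 Q2)
      from Q2(3-) show ?case
      proof (induction s arbitrary: N1 N2 rule: measure_induct_rule[of length])
        case len: (less s)
        have "SN T" if "apps (App H (Case N1 N2)) s \<triangleright> T" for T
          using that
        proof (cases rule: red_appsE)
          case (head T')
          from head(1) show ?thesis
          proof (cases rule: red_AppE)
            case root
            then show ?thesis
              by (cases rule: root.cases) (use len(2) head(2) in \<open>auto elim: case_head.cases\<close>)
          next
            case (left H')
            then show ?thesis
              using H(2)[OF left(1) Q1(1) Q2(1) case_head_red[OF len(2) left(1)] len(3,4)] head(2) by simp
          next
            case (right e')
            from right(1) consider N1' where "N1 \<triangleright> N1'" "e' = Case N1' N2" | N2' where "N2 \<triangleright> N2'" "e' = Case N1 N2'"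
              by (auto elim: red_CaseE)
            then show ?thesis
            proof cases
              case (1 N1')
              then show ?thesis
                using Q1(2)[OF _ Q2(1) case_head_red_branch(1)[OF len(2) 1(1)] refl len(4)] len(3) right(2) head(2)
                by (simp add: red_apps)
            next
              case (2 N2')
              then show ?thesis
                using Q2(2)[OF _ case_head_red_branch(2)[OF len(2) 2(1)] len(3) refl] len(4) right(2) head(2)
                by (simp add: red_apps)
            qed
          qed
        next
          case (stack s')
          \<comment> \<open>A stack step reduces both \<open>Q1\<close> and \<open>Q2\<close>. The
            decrease of \<open>Q1\<close> suffices; \<open>Q2\<close> only has to stay strongly
            normalizing.\<close>
          have "SN (apps N2 (map sh_ve s'))"
            using SN_red[OF Q2(1)] len(4) stack(1) by (simp add: sred_apps sred_shift)
          then show ?thesis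
            using Q1(2)[OF _ _ case_head_red_branch(3)[OF len(2) stack(1)] refl refl] len(3) stack
            by (simp add: sred_apps sred_shift)
        next
          case (root e s' P)
          from root(2) have "P = App H (Case (App N1 (sh_ve e)) (App N2 (sh_ve e)))"
            using len(2) by (cases rule: root.cases) (auto elim: case_head.cases)
          then show ?thesis
            using len(1)[OF _ case_head_perm] len(2-) root by simp
        qed
        then show ?case unfolding apps_simps by (rule SN_I)
      qed
    qed
  qed
qed

text \<open>Stacks shrink when a \<open>\<mu>\<close> consumes their first element, so termination of \<open>sred\<close> is
  combined with taking tails.\<close>

lemma SN_stack:
  assumes "SN (apps M s)"
  shows "Wellfounded.accp (\<lambda>t s. sred s t \<or> (\<exists>e. s = e # t)) s"
proof -
  have "Wellfounded.accp (\<lambda>t s. sred s t) s"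
    using assms by (rule accp_inv_image[where f = "apps M"]) (rule sred_apps)
  \<comment> \<open>The claim is strengthened to all suffixes: a step in \<open>t\<close> is a step
    in the whole of \<open>s\<close>, whereas dropping an element moves it into \<open>u\<close> and
    leaves \<open>s\<close> fixed.\<close>
  then have "\<forall>u t. s = u @ t \<longrightarrow> Wellfounded.accp (\<lambda>t s. sred s t \<or> (\<exists>e. s = e # t)) t"
  proof (induction rule: accp_induct_rule)
    case (1 s)
    have "s = u @ t \<Longrightarrow> Wellfounded.accp (\<lambda>t s. sred s t \<or> (\<exists>e. s = e # t)) t" for u t
    proof (induction t arbitrary: u rule: measure_induct_rule[of length])
      case (less t)
      have app: "sred (u @ t) (u @ t')" if "sred t t'" for t'
        using that by (induction u) (auto intro: sred_tail)
      show ?case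
      proof (rule accp.accI, elim disjE exE)
        fix y assume "sred t y"
        with app less.prems have "sred s (u @ y)" by simp
        from 1(2)[OF this] show "Wellfounded.accp (\<lambda>t s. sred s t \<or> (\<exists>e. s = e # t)) y" by blast
      next
        fix y e assume "t = e # y"
        with less.IH[of y "u @ [e]"] less.prems
        show "Wellfounded.accp (\<lambda>t s. sred s t \<or> (\<exists>e. s = e # t)) y" by simp
      qed
    qed
    then show ?case by blast
  qed
  then show ?thesis by simp
qed

text \<open>When the \<mu> consumes the first eliminator, \<open>msub0_Cons\<close> leaves the fully
  instantiated body \<open>msub0 M s\<close> unchanged and \<open>s\<close> becomes its tail. A step
  in \<open>s\<close> may also leave no trace in that body. Hence the outer induction is on
  \<open>s\<close>; steps in \<open>M\<close> belong to the inner one.\<close>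

lemma SN_mu:
  assumes "Wellfounded.accp (\<lambda>t s. sred s t \<or> (\<exists>e. s = e # t)) s" and "SN (msub0 M s)"
  shows "SN (apps (Mu M) s)"
  using assms
proof (induction arbitrary: M rule: accp_induct_rule)
  case s: (1 s)
  from s(3) show ?case
  proof (induction "msub0 M s" arbitrary: M rule: accp_induct_rule)
    case M: 1
    have "SN T" if "apps (Mu M) s \<triangleright> T" for T
      using that
    proof (cases rule: red_appsE)
      case (head H')
      then obtain M' where "M \<triangleright> M'" "H' = Mu M'" by (auto elim: redEs)
      then show ?thesis using M(2)[OF red_msub0] head by simp
    next
      case (stack s')
      then show ?thesis using s(2)[of s' M] SN_reds[OF reds_msub0 M(1)] by auto
    next
      case (root e s' P)
      then have "P = Mu (msub0 M [e])" by (auto elim: root.cases)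
      then show ?thesis using s(2)[of s' "msub0 M [e]"] M(1) root by (simp add: msub0_Cons)
    qed
    then show ?case unfolding apps_simps by (rule SN_I)
  qed
qed

section \<open>Reducibility by orthogonality\<close>

text \<open>The branches of a \<open>Case\<close> may have any result type, possibly larger than
  \<open>Disj A B\<close>, so recursion cannot refer to its stacks. The rest \<open>s\<close> is
  therefore left untyped, and only the instantiated branches in front of it must be strongly
  normalizing. The empty stack is always included so that reducible terms normalize
  strongly.\<close>

primrec stacks :: "'a ty \<Rightarrow> elim list set" where
  "stacks (Atom X) = {[]}"
| "stacks Bot = {[]}"
| "stacks (Imp A B) = insert [] {Arg N # s | N s. (\<forall>t\<in>stacks A. SN (apps N t)) \<and> s \<in> stacks B}"
| "stacks (Conj A B) = insert [] ((#) Proj1 ` stacks A \<union> (#) Proj2 ` stacks B)"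
| "stacks (Disj A B) = insert [] {Case N1 N2 # s | N1 N2 s.
     (\<forall>M. (\<forall>t\<in>stacks A. SN (apps M t)) \<longrightarrow> SN (apps (subst N1 M 0) s)) \<and>
     (\<forall>M. (\<forall>t\<in>stacks B. SN (apps M t)) \<longrightarrow> SN (apps (subst N2 M 0) s))}"

definition reducible :: "'a ty \<Rightarrow> trm set" where
  "reducible A = {M. \<forall>s\<in>stacks A. SN (apps M s)}"

lemma Nil_stacks: "[] \<in> stacks A"
  by (cases A) auto

lemma reducible_SN: "M \<in> reducible A \<Longrightarrow> SN M"
  using Nil_stacks by (force simp: reducible_def)

lemma reducibleD: "M \<in> reducible A \<Longrightarrow> s \<in> stacks A \<Longrightarrow> SN (apps M s)"
  by (simp add: reducible_def)

text \<open>Substituting for variable 0 cancels the shifts in the stack, and strong normalization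
  reflects along substitution.\<close>

lemma SN_branch:
  assumes "SN (apps (subst N M 0) s)"
  shows "SN (apps N (map sh_ve s))"
proof -
  have "subst (apps N (map sh_ve s)) M 0 = apps (subst N M 0) s"
    by (induction s arbitrary: N) simp_all
  then show ?thesis using assms by (metis SN_psub subst0_psub)
qed

text \<open>Besides instantiating free variables, this supplies test arguments under binders and
  shows that the stacks of every type terminate, as required for \<open>SN_mu\<close>.\<close>

lemma Var_reducible: "Var x \<in> reducible A"
proof (induction A arbitrary: x)
  case (Imp A B)
  have "SN (apps (Var x) (Arg N # s))" if "N \<in> reducible A" "s \<in> stacks B" for N s
    using that Imp(2)[of x] by (intro SN_Var_apps SN_e_Arg) (auto dest: reducible_SN reducibleD)
  then show ?case by (auto simp: reducible_def SN_Var)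
next
  case (Conj A B)
  then show ?case
    using SN_Var_apps[OF SN_e_Proj(1)] SN_Var_apps[OF SN_e_Proj(2)]
    by (fastforce simp: reducible_def SN_Var)
next
  case (Disj A B)
  have "SN (apps (Var x) (Case N1 N2 # s))"
    if "\<forall>M\<in>reducible A. SN (apps (subst N1 M 0) s)" "\<forall>M\<in>reducible B. SN (apps (subst N2 M 0) s)" for N1 N2 s
    using that Disj[of x] by (intro SN_case[OF SN_Var _ _ _ refl refl] SN_branch[of _ "Var x"]) (auto intro: case_head.intros)
  then show ?case by (auto simp: reducible_def SN_Var)
qed (auto simp: reducible_def SN_Var)

section \<open>Instantiation of binders and adequacy\<close>

lemma subst0_psub_up:
  "subst (psub M (up_v \<sigma>) \<theta> (\<lambda>a. map sh_ve (\<kappa> a))) N 0 = psub M (case_nat N \<sigma>) \<theta> \<kappa>"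
  by (auto simp: subst0_psub psub_psub shift_ren psub_ren up_v_def comp_def split: nat.split
      intro!: arg_cong[where f = "\<lambda>f. psub M f \<theta> \<kappa>"])

text \<open>Free \<open>\<mu>\<close>-variables may be identified without affecting reduction, so a stack living
  outside the binder need not be shifted.\<close>

lemma ren_msub0_psub_up:
  "ren (msub0 (psub M (\<lambda>x. sh_m (\<sigma> x)) (up_ren \<theta>) (up_m \<kappa>)) s) id (case_nat 0 id) =
   psub M \<sigma> (case_nat 0 \<theta>) (case_nat s \<kappa>)"
proof -
  have "(\<lambda>a. case up_ren \<theta> a of 0 \<Rightarrow> 0 | Suc x \<Rightarrow> x) = case_nat 0 \<theta>"
    by (auto simp: up_ren_def fun_eq_iff split: nat.split)
  then show ?thesis
    by (auto simp: msub0_def psub_psub ren_psub_Var shift_ren psub_ren up_m_def up_ren_def comp_def id_def fun_eq_iff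
        split: nat.split intro!: arg_cong2[where f = "psub M \<sigma>"])
qed

lemma reducible_case_nat:
  assumes "N \<in> reducible A" and "\<forall>x B. \<Gamma> x = Some B \<longrightarrow> \<sigma> x \<in> reducible B"
  shows "\<forall>x B. (A \<Colon> \<Gamma>) x = Some B \<longrightarrow> case_nat N \<sigma> x \<in> reducible B"
  using assms by (auto simp: ctx_ext_def split: nat.splits)

lemma stacks_case_nat:
  assumes "s \<in> stacks A" and "\<forall>a B. \<Delta> a = Some B \<longrightarrow> \<kappa> a \<in> stacks B"
  shows "\<forall>a B. (A \<Colon> \<Delta>) a = Some B \<longrightarrow> case_nat s \<kappa> a \<in> stacks B"
  using assms by (auto simp: ctx_ext_def split: nat.splits)

text \<open>Induction on typing, with each rule reduced to a head expansion. Stacks for the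
  \<mu>-variables make \<open>Nam a L\<close> a name applied to \<open>L\<close> in front of a stack
  of its type. The renaming \<open>\<theta>\<close> is arbitrary, which leaves the name of a bound
  \<mu>-variable free to choose.\<close>

lemma adequacy:
  assumes "\<Gamma>; \<Delta> \<turnstile> M : A"
    and "\<forall>x B. \<Gamma> x = Some B \<longrightarrow> \<sigma> x \<in> reducible B"
    and "\<forall>a B. \<Delta> a = Some B \<longrightarrow> \<kappa> a \<in> stacks B"
  shows "psub M \<sigma> \<theta> \<kappa> \<in> reducible A"
  using assms
proof (induction arbitrary: \<sigma> \<theta> \<kappa> rule: typing.induct)
  case (imp_i A \<Gamma> \<Delta> M B)
  let ?M = "psub M (up_v \<sigma>) \<theta> (\<lambda>a. map sh_ve (\<kappa> a))"
  have body: "SN (apps (subst ?M N 0) s)" if "N \<in> reducible A" "s \<in> stacks B" for N s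
    unfolding subst0_psub_up
    by (rule reducibleD[OF imp_i.IH[OF reducible_case_nat[OF that(1) imp_i.prems(1)] imp_i.prems(2)] that(2)])
  \<comment> \<open>A variable as argument and the empty stack give the body itself, as needed for
    the bare abstraction.\<close>
  have "SN ?M" using SN_branch[where s = "[]"] body[OF Var_reducible Nil_stacks] by fastforce
  then have "SN (Lam ?M)" by (rule SN_Lam)
  moreover have "SN (apps (Lam ?M) (Arg N # s))" if "N \<in> reducible A" "s \<in> stacks B" for N s
    using that by (intro SN_beta body reducible_SN)
  ultimately show ?case by (auto simp: reducible_def)
next
  case (imp_e \<Gamma> \<Delta> M A B N)
  have "Arg (psub N \<sigma> \<theta> \<kappa>) # s \<in> stacks (Imp A B)" if "s \<in> stacks B" for s
    using that imp_e.IH(2)[OF imp_e.prems] by (auto simp: reducible_def)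
  from reducibleD[OF imp_e.IH(1)[OF imp_e.prems] this] show ?case
    by (simp add: reducible_def)
next
  case (bot_i \<Delta> a A \<Gamma> M)
  then show ?case by (auto simp: reducible_def intro!: SN_Nam)
next
  case (bot_e \<Gamma> A \<Delta> M)
  have "SN (apps (psub (Mu M) \<sigma> \<theta> \<kappa>) s)" if s: "s \<in> stacks A" for s
  proof -
    \<comment> \<open>The bound \<mu>-variable is instantiated by the stack \<open>s\<close> that
      the \<mu> will consume, and is named 0. This may clash with a free name, but the renaming
      involved reflects strong normalization.\<close>
    note reducible_SN[OF bot_e.IH[OF bot_e.prems(1) stacks_case_nat[OF s bot_e.prems(2)], where \<theta> = "case_nat 0 \<theta>"]]
    then have "SN (msub0 (psub M (\<lambda>x. sh_m (\<sigma> x)) (up_ren \<theta>) (up_m \<kappa>)) s)"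
      by (metis ren_msub0_psub_up ren_psub_Var(1) SN_psub)
    \<comment> \<open>Termination of \<open>s\<close> is read off from a variable placed in front of
      it.\<close>
    then show ?thesis
      using SN_mu SN_stack[OF reducibleD[OF Var_reducible s]] by simp
  qed
  then show ?case by (simp add: reducible_def)
next
  case (conj_i \<Gamma> \<Delta> M A1 N A2)
  note M = conj_i.IH(1)[OF conj_i.prems] and N = conj_i.IH(2)[OF conj_i.prems]
  have "SN (apps (Pair (psub M \<sigma> \<theta> \<kappa>) (psub N \<sigma> \<theta> \<kappa>)) t)" if "t \<in> stacks (Conj A1 A2)" for t
  proof -
    from that consider "t = []" | s where "t = Proj1 # s" "s \<in> stacks A1"
      | s where "t = Proj2 # s" "s \<in> stacks A2" by auto
    then show ?thesis
    proof cases
      case 1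
      then show ?thesis by (simp add: SN_Pair[OF reducible_SN[OF M] reducible_SN[OF N]])
    next
      case (2 s)
      show ?thesis unfolding 2(1) by (rule SN_Proj1[OF reducible_SN[OF N] reducibleD[OF M 2(2)]])
    next
      case (3 s)
      show ?thesis unfolding 3(1) by (rule SN_Proj2[OF reducible_SN[OF M] reducibleD[OF N 3(2)]])
    qed
  qed
  then show ?case unfolding reducible_def psub.simps by blast
next
  case (conj_e1 \<Gamma> \<Delta> M A1 A2)
  have "Proj1 # s \<in> stacks (Conj A1 A2)" if "s \<in> stacks A1" for s
    using that by simp
  from reducibleD[OF conj_e1.IH[OF conj_e1.prems] this] show ?case
    by (simp add: reducible_def)
next
  case (conj_e2 \<Gamma> \<Delta> M A1 A2)
  have "Proj2 # s \<in> stacks (Conj A1 A2)" if "s \<in> stacks A2" for s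
    using that by simp
  from reducibleD[OF conj_e2.IH[OF conj_e2.prems] this] show ?case
    by (simp add: reducible_def)
next
  case (disj_i1 \<Gamma> \<Delta> M A1 A2)
  note M = disj_i1.IH[OF disj_i1.prems]
  have "SN (apps (psub (Inj1 M) \<sigma> \<theta> \<kappa>) (Case N1 N2 # s))"
    if "\<forall>M\<in>reducible A1. SN (apps (subst N1 M 0) s)" "\<forall>M\<in>reducible A2. SN (apps (subst N2 M 0) s)" for N1 N2 s
    \<comment> \<open>Instantiation by the reducible \<open>Var 0\<close> shows that both branches
      in front of the shifted stack are strongly normalizing, including the one the contraction
      discards.\<close>
    unfolding psub.simps using that M Var_reducible[of 0]
    by (intro SN_case[OF SN_Inj1[OF reducible_SN[OF M]] _ _ _ refl refl] SN_branch[of _ "Var 0"])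
      (auto intro: case_head.intros)
  then show ?case
    using SN_Inj1[OF reducible_SN[OF M]] by (auto simp: reducible_def)
next
  case (disj_i2 \<Gamma> \<Delta> M A2 A1)
  note M = disj_i2.IH[OF disj_i2.prems]
  have "SN (apps (psub (Inj2 M) \<sigma> \<theta> \<kappa>) (Case N1 N2 # s))"
    if "\<forall>M\<in>reducible A1. SN (apps (subst N1 M 0) s)" "\<forall>M\<in>reducible A2. SN (apps (subst N2 M 0) s)" for N1 N2 s
    unfolding psub.simps using that M Var_reducible[of 0]
    by (intro SN_case[OF SN_Inj2[OF reducible_SN[OF M]] _ _ _ refl refl] SN_branch[of _ "Var 0"])
      (auto intro: case_head.intros)
  then show ?case
    using SN_Inj2[OF reducible_SN[OF M]] by (auto simp: reducible_def)
next
  case (disj_e \<Gamma> \<Delta> M A1 A2 N1 C N2)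
  let ?N = "\<lambda>N. psub N (up_v \<sigma>) \<theta> (\<lambda>a. map sh_ve (\<kappa> a))"
  have "SN (apps (subst (?N N1) P 0) s)" if "P \<in> reducible A1" "s \<in> stacks C" for P s
    unfolding subst0_psub_up
    by (rule reducibleD[OF disj_e.IH(2)[OF reducible_case_nat[OF that(1) disj_e.prems(1)] disj_e.prems(2)] that(2)])
  moreover have "SN (apps (subst (?N N2) P 0) s)" if "P \<in> reducible A2" "s \<in> stacks C" for P s
    unfolding subst0_psub_up
    by (rule reducibleD[OF disj_e.IH(3)[OF reducible_case_nat[OF that(1) disj_e.prems(1)] disj_e.prems(2)] that(2)])
  \<comment> \<open>Here \<open>s\<close> is a stack of the result type \<open>C\<close>.
    Reducibility of the branches at \<open>C\<close> yields exactly the condition in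
    \<open>stacks\<close>, which does not mention \<open>C\<close>.\<close>
  ultimately have "Case (?N N1) (?N N2) # s \<in> stacks (Disj A1 A2)" if "s \<in> stacks C" for s
    using that by (auto simp: reducible_def)
  from reducibleD[OF disj_e.IH(1)[OF disj_e.prems] this] show ?case
    by (simp add: reducible_def)
qed (auto simp: reducible_def)

theorem theorem6p9:
  fixes \<Gamma> \<Delta> :: "'a ctx" and M :: trm and A :: "'a ty"
  assumes "\<Gamma>; \<Delta> \<turnstile> M : A"
  shows "\<not> (\<exists>f :: nat \<Rightarrow> trm. f 0 = M \<and> (\<forall>i. f i \<triangleright> f (Suc i)))"
proof -
  \<comment> \<open>The identity substitution is admissible: variables are reducible, and the empty
    stack belongs to every type.\<close>
  have "psub M Var (\<lambda>a. a) (\<lambda>_. []) \<in> reducible A"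
    using assms by (rule adequacy) (simp_all add: Var_reducible Nil_stacks)
  then have "SN M" by (simp add: reducible_SN)
  then have "\<forall>f. f 0 = M \<longrightarrow> \<not> (\<forall>i. f i \<triangleright> f (Suc i))"
  proof (induction rule: accp_induct_rule)
    case (1 M)
    show ?case
    proof (intro allI impI notI)
      fix f :: "nat \<Rightarrow> trm" assume "f 0 = M" and f: "\<forall>i. f i \<triangleright> f (Suc i)"
      then have "M \<triangleright> f (Suc 0)" by blast
      from 1(2)[OF this, rule_format, of "\<lambda>i. f (Suc i)"] f show False by simp
    qed
  qed
  then show ?thesis by blast
qed

end
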